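(* Let $K_{r,s}$ with $r,s>1$ be a complete bipartite graph with $V(K_{r,s})=V_1\cup V_2$ (the two parts), where $V_1=\{x_1,\ldots,x_r\}$ and $V_2=\{x_{r+1},\ldots,x_{r+s}\}$, and let $\mathfrak{m}=(x_1,\ldots,x_{r+s})\subset R=K[x_1,\ldots,x_{r+s}]$ be the unique homogeneous maximal ideal, $K$ a field. Then, for all integers $t\ge3$, $$\mathfrak{m}\in\mathrm{Ass}(NI(K_{r,s})^t)\setminus\bigl(\mathrm{Ass}(NI(K_{r,s}))\cup\mathrm{Ass}(NI(K_{r,s})^2)\bigr).$$ In particular, $\mathrm{depth}(R/NI(K_{r,s})^t)=0$ for all $t\ge3$, and $\lim_{k\to\infty}\mathrm{depth}(R/NI(K_{r,s})^k)=0$.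
   Context: For a finite simple graph $G$ whose vertices are identified with variables of a polynomial ring $R$, the closed neighborhood ideal $NI(G)\subset R$ is generated by the monomials $\prod_{u\in N_G[v]}u$, $v\in V(G)$, where $N_G[v]=\{v\}\cup\{u:\{u,v\}\in E(G)\}$. For an ideal $I\subset R$, $\mathrm{Ass}(I)$ means $\mathrm{Ass}_R(R/I)$, the set of associated primes of $I$. *)

theory Defs
  imports
    "Graph_Theory.Kuratowski"
    "HOL-Library.Poly_Mapping"
    "HOL-Library.Extended_Real"
    "HOL-Algebra.Module"
    "HOL-Algebra.QuotRing"
    "HOL-Algebra.Ideal_Product"
begin

text \<open>
  Several notions needed here (polynomial rings in several variables as ring records, cyclic
  modules, associated primes, depth) are not in the libraries and are defined below. Ideals,
  products and powers of ideals, and quotient rings are those of HOL-Algebra; graphs are the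
  symmetric loop-free digraphs of \<open>Graph_Theory\<close>.
\<close>

section \<open>Polynomial rings\<close>

text \<open>
  A polynomial is a finitely supported map from monomials (finitely supported exponent vectors)
  to coefficients; with multiplication from \<open>Poly_Mapping\<close> being convolution, the type is the
  polynomial ring in variables indexed by the whole type \<^typ>\<open>'v\<close>.
  The ring \<open>mpoly_ring V\<close> is its subring of polynomials in the variables indexed by \<open>V\<close> only.
\<close>

type_synonym ('v, 'k) mpoly = "('v \<Rightarrow>\<^sub>0 nat) \<Rightarrow>\<^sub>0 'k"

definition mpoly_ring :: "'v set \<Rightarrow> ('v, 'k::field) mpoly ring" where
  "mpoly_ring V =
     \<lparr> carrier = {p. \<forall>m \<in> Poly_Mapping.keys p. Poly_Mapping.keys m \<subseteq> V},
       mult = (*), one = 1, zero = 0, add = (+) \<rparr>"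

definition Var :: "'v \<Rightarrow> ('v, 'k::field) mpoly" where
  "Var v = Poly_Mapping.single (Poly_Mapping.single v 1) 1"

lemma cring_mpoly_ring: "cring (mpoly_ring V :: ('v, 'k::field) mpoly ring)"
proof -
  let ?C = "{p :: ('v, 'k) mpoly. \<forall>m \<in> Poly_Mapping.keys p. Poly_Mapping.keys m \<subseteq> V}"
  have plus: "p + q \<in> ?C" if "p \<in> ?C" "q \<in> ?C" for p q
    using that Poly_Mapping.keys_add[of p q] by blast
  have times: "p * q \<in> ?C" if "p \<in> ?C" "q \<in> ?C" for p q
  proof (rule CollectI, rule ballI)
    fix m assume "m \<in> Poly_Mapping.keys (p * q)"
    then obtain a b where "m = a + b" "a \<in> Poly_Mapping.keys p" "b \<in> Poly_Mapping.keys q"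
      using keys_mult[of p q] by blast
    then show "Poly_Mapping.keys m \<subseteq> V"
      using that Poly_Mapping.keys_add[of a b] by blast
  qed
  have uminus: "- p \<in> ?C" if "p \<in> ?C" for p
    using that by simp
  let ?R = "mpoly_ring V :: ('v, 'k) mpoly ring"
  have sel: "carrier ?R = ?C" "x \<otimes>\<^bsub>?R\<^esub> y = x * y" "\<one>\<^bsub>?R\<^esub> = 1" "\<zero>\<^bsub>?R\<^esub> = 0" "x \<oplus>\<^bsub>?R\<^esub> y = x + y" for x y
    by (simp_all add: mpoly_ring_def)
  have zero: "0 \<in> ?C" and one: "1 \<in> ?C"
    by simp_all
  show ?thesis
  proof (rule cringI)
    show "abelian_group ?R"
    proof (rule abelian_groupI, unfold sel)
      fix x assume "x \<in> ?C"
      then show "\<exists>y \<in> ?C. y + x = 0"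
        by (intro bexI[of _ "- x"] uminus) (rule add.left_inverse)
    qed (fact plus zero | rule add_0_left add.assoc add.commute)+
    show "comm_monoid ?R"
      by (rule comm_monoidI, unfold sel)
        (fact times one | rule mult_1_left mult.assoc mult.commute)+
  qed (unfold sel, rule distrib_right)
qed

section \<open>Closed neighborhood ideals\<close>

definition closed_nbhd :: "('v, 'e) pre_digraph \<Rightarrow> 'v \<Rightarrow> 'v set" where
  "closed_nbhd G v = {v} \<union> {u. (u, v) \<in> arcs_ends G}"

definition NI :: "('v, 'k::field) mpoly ring \<Rightarrow> ('v, 'e) pre_digraph \<Rightarrow> ('v, 'k) mpoly set" where
  "NI R G = genideal R {\<Prod>u \<in> closed_nbhd G v. Var u | v. v \<in> verts G}"

text \<open>The complete bipartite graph with parts \<open>{1, ..., r}\<close> and \<open>{r + 1, ..., r + s}\<close>.\<close>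

definition complete_bipartite :: "nat \<Rightarrow> nat \<Rightarrow> nat pair_pre_digraph" where
  "complete_bipartite r s =
     \<lparr> pverts = {1..r} \<union> {r + 1..r + s},
       parcs = {1..r} \<times> {r + 1..r + s} \<union> {r + 1..r + s} \<times> {1..r} \<rparr>"

lemma complete_bipartite_is_Krs:
  "complete_bipartite_digraph r s (with_proj (complete_bipartite r s))"
  unfolding complete_bipartite_digraph_pair_def complete_bipartite_def
  by (rule conjI, simp, rule exI[of _ "{1..r}"], rule exI[of _ "{r + 1..r + s}"]) simp

section \<open>Associated primes\<close>

text \<open>\<open>R / I\<close> as an \<open>R\<close>-module: \<open>R\<close> acts through the projection to the quotient ring.\<close>

definition quot_module :: "('a, 'b) ring_scheme \<Rightarrow> 'a set \<Rightarrow> ('a, 'a set) module" where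
  "quot_module R I =
     \<lparr> carrier = carrier (R Quot I), mult = mult (R Quot I), one = one (R Quot I),
       zero = zero (R Quot I), add = add (R Quot I),
       smult = (\<lambda>a X. (I +>\<^bsub>R\<^esub> a) \<otimes>\<^bsub>R Quot I\<^esub> X) \<rparr>"

lemma module_quot_module:
  assumes "cring R" "ideal I R"
  shows "Module.module R (quot_module R I)"
proof -
  interpret cring R by fact
  interpret I: ideal I R by fact
  interpret Q: cring "R Quot I" by (rule I.quotient_is_cring[OF assms(1)])
  interpret h: ring_hom_ring R "R Quot I" "(+>\<^bsub>R\<^esub>) I" by (rule I.rcos_ring_hom_ring)
  have ab: "abelian_group (quot_module R I)"
  proof (rule abelian_groupI)
    fix X assume "X \<in> carrier (quot_module R I)"
    then show "\<exists>Y \<in> carrier (quot_module R I). Y \<oplus>\<^bsub>quot_module R I\<^esub> X = \<zero>\<^bsub>quot_module R I\<^esub>"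
      using Q.l_neg[of X] Q.a_inv_closed[of X] unfolding quot_module_def by auto
  qed (simp_all add: quot_module_def Q.a_ac)
  note [simp del] = h.hom_one
  show ?thesis
  proof (rule Module.moduleI)
    fix X assume "X \<in> carrier (quot_module R I)"
    then show "\<one>\<^bsub>R\<^esub> \<odot>\<^bsub>quot_module R I\<^esub> X = X"
      using h.hom_one Q.l_one[of X] by (simp add: quot_module_def)
  qed (simp_all add: quot_module_def assms(1) ab[unfolded quot_module_def] Q.m_assoc Q.l_distr Q.r_distr)
qed

definition annihilator :: "('a, 'b) ring_scheme \<Rightarrow> ('a, 'm, 'c) module_scheme \<Rightarrow> 'm \<Rightarrow> 'a set" where
  "annihilator R M x = {a \<in> carrier R. a \<odot>\<^bsub>M\<^esub> x = \<zero>\<^bsub>M\<^esub>}"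

definition associated_primes ::
    "('a, 'b) ring_scheme \<Rightarrow> ('a, 'm, 'c) module_scheme \<Rightarrow> 'a set set" where
  "associated_primes R M = {P. primeideal P R \<and> (\<exists>x \<in> carrier M. P = annihilator R M x)}"

definition Ass :: "('a, 'b) ring_scheme \<Rightarrow> 'a set \<Rightarrow> 'a set set" where
  "Ass R I = associated_primes R (quot_module R I)"

section \<open>Depth\<close>

text \<open>The submodule \<open>(a\<^sub>1, ..., a\<^sub>n)M\<close> of \<open>M\<close>.\<close>

definition seq_smult :: "('a, 'm, 'c) module_scheme \<Rightarrow> 'a list \<Rightarrow> 'm set" where
  "seq_smult M as =
     {finsum M (\<lambda>i. (as ! i) \<odot>\<^bsub>M\<^esub> f i) {..<length as} | f. \<forall>i < length as. f i \<in> carrier M}"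

text \<open>
  The implication in the second conjunct says that \<open>a\<^sub>i\<close> is a nonzerodivisor on
  \<open>M / (a\<^sub>1, ..., a\<^sub>i\<^sub>-\<^sub>1)M\<close>, written without the quotient module.
\<close>

definition regular_sequence ::
    "('a, 'b) ring_scheme \<Rightarrow> ('a, 'm, 'c) module_scheme \<Rightarrow> 'a list \<Rightarrow> bool" where
  "regular_sequence R M as \<longleftrightarrow>
     set as \<subseteq> carrier R \<and>
     (\<forall>i < length as. \<forall>x \<in> carrier M.
        (as ! i) \<odot>\<^bsub>M\<^esub> x \<in> seq_smult M (take i as) \<longrightarrow> x \<in> seq_smult M (take i as)) \<and>
     seq_smult M as \<noteq> carrier M"

text \<open>
  Depth with respect to an ideal \<open>J\<close> (the homogeneous maximal ideal, in the graded case), as the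
  supremum of the lengths of regular sequences in \<open>J\<close>. The zero module has depth \<open>\<infinity>\<close>.
\<close>

definition depth ::
    "('a, 'b) ring_scheme \<Rightarrow> 'a set \<Rightarrow> ('a, 'm, 'c) module_scheme \<Rightarrow> enat" where
  "depth R J M =
     (if carrier M = {\<zero>\<^bsub>M\<^esub>} then \<infinity>
      else Sup {enat (length as) | as. set as \<subseteq> J \<and> regular_sequence R M as})"

end

theory Submission
  imports Defs
begin

text \<open>
  Write \<open>X\<close> and \<open>Y\<close> for the two parts, \<open>A\<close> and \<open>B\<close> for the products of the variables in \<open>X\<close> and
  in \<open>Y\<close>. The ideal \<open>NI(K\<^sub>r\<^sub>,\<^sub>s)\<close> is generated by the monomials \<open>x B\<close> with \<open>x \<in> X\<close> and \<open>y A\<close> with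
  \<open>y \<in> Y\<close>. Everything reduces to exponent vectors, because all ideals involved are spanned by
  monomials.

  A monomial \<open>m\<close> is divisible by a product of \<open>a\<close> generators \<open>x B\<close> and \<open>b\<close> generators \<open>y A\<close>
  if and only if all its exponents on \<open>X\<close> are at least \<open>b\<close>, all its exponents on \<open>Y\<close> are at
  least \<open>a\<close>, and its degrees in \<open>X\<close> and \<open>Y\<close> are at least \<open>r b + a\<close> and \<open>s a + b\<close>. So the monomials
  of the \<open>t\<close>-th power are those that satisfy these inequalities for some \<open>a + b = t\<close>
  (\<open>power_genideal\<close>).

  The maximal ideal is associated to a monomial ideal if and only if some monomial outside the
  ideal is pushed into it by every variable (\<open>irrelevant_in_Ass_iff\<close>): such a monomial spans a
  copy of \<open>R/\<mm>\<close>, and conversely any polynomial annihilated by \<open>\<mm>\<close> modulo the ideal has such a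
  monomial among its terms. For \<open>t \<ge> 3\<close> the monomial \<open>A\<^sup>t\<^sup>-\<^sup>1 B\<^sup>2 y\<^sup>t\<^sup>-\<^sup>3\<close>, with any one \<open>y \<in> Y\<close>, works
  (\<open>corner_power_exps\<close>): it misses the inequalities for \<open>a = 1\<close> by one in the degree in \<open>X\<close> and
  those for \<open>a = 2\<close> by one in the degree in \<open>Y\<close>, and all other values of \<open>a\<close> are excluded by a
  single exponent. For \<open>t \<le> 2\<close> there are too few splittings \<open>a + b = t\<close> for this
  (\<open>no_corner_power_exps\<close>).

  Finally, an associated prime annihilates a nonzero element, so it contains no element that could
  start a regular sequence, and the depth with respect to it is zero
  (\<open>depth_associated_prime\<close>). The limit is that of an eventually constant sequence.
\<close>

section \<open>Ideals spanned by monomials\<close>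

definition mons :: "'v set \<Rightarrow> ('v \<Rightarrow>\<^sub>0 nat) set" where
  "mons V = {m. Poly_Mapping.keys m \<subseteq> V}"

definition monomial_span :: "('v \<Rightarrow>\<^sub>0 nat) set \<Rightarrow> ('v, 'k::field) mpoly set" where
  "monomial_span S = {p. Poly_Mapping.keys p \<subseteq> S}"

text \<open>The sets of exponent vectors of the monomials of a monomial ideal in the variables \<open>V\<close>.\<close>

definition up_closed :: "'v set \<Rightarrow> ('v \<Rightarrow>\<^sub>0 nat) set \<Rightarrow> bool" where
  "up_closed V S \<longleftrightarrow> S \<subseteq> mons V \<and> (\<forall>m \<in> S. \<forall>n \<in> mons V. n + m \<in> S)"

lemma mons_add: "m \<in> mons V \<Longrightarrow> n \<in> mons V \<Longrightarrow> m + n \<in> mons V"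
  unfolding mons_def using Poly_Mapping.keys_add[of m n] by blast

lemma mons_0 [simp]: "0 \<in> mons V"
  by (simp add: mons_def)

lemma mons_single [simp]: "i \<in> V \<Longrightarrow> Poly_Mapping.single i c \<in> mons V"
  by (simp add: mons_def)

lemma mons_sum: "(\<And>i. i \<in> A \<Longrightarrow> f i \<in> mons V) \<Longrightarrow> sum f A \<in> mons V"
  by (induction A rule: infinite_finite_induct) (auto intro: mons_add)

lemma carrier_mpoly_ring: "carrier (mpoly_ring V) = monomial_span (mons V)"
  by (auto simp: mpoly_ring_def monomial_span_def mons_def)

lemma mpoly_ring_sel [simp]:
  "x \<otimes>\<^bsub>mpoly_ring V\<^esub> y = x * y" "x \<oplus>\<^bsub>mpoly_ring V\<^esub> y = x + y"
  "\<one>\<^bsub>mpoly_ring V\<^esub> = 1" "\<zero>\<^bsub>mpoly_ring V\<^esub> = 0"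
  by (simp_all add: mpoly_ring_def)

lemma single_in_monomial_span [simp]:
  "m \<in> S \<Longrightarrow> Poly_Mapping.single m c \<in> monomial_span S"
  by (simp add: monomial_span_def)

lemma monomial_span_add:
  "p \<in> monomial_span S \<Longrightarrow> q \<in> monomial_span S \<Longrightarrow> p + q \<in> monomial_span S"
  unfolding monomial_span_def using Poly_Mapping.keys_add[of p q] by blast

lemma monomial_span_mono: "S \<subseteq> T \<Longrightarrow> monomial_span S \<subseteq> monomial_span T"
  by (auto simp: monomial_span_def)

lemma monomial_span_mult:
  assumes "p \<in> monomial_span S" "q \<in> monomial_span T"
  shows "p * q \<in> monomial_span {m + n | m n. m \<in> S \<and> n \<in> T}"
  using assms keys_mult[of p q] unfolding monomial_span_def by blast

text \<open>
  A polynomial is the finite sum of its terms; through this, all later inclusions of a span in an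
  ideal come down to single terms.
\<close>

lemma monomial_span_subsetI:
  fixes J :: "('v, 'k::field) mpoly set"
  assumes "0 \<in> J"
    and add: "\<And>p q. p \<in> J \<Longrightarrow> q \<in> J \<Longrightarrow> p + q \<in> J"
    and single: "\<And>m c. m \<in> S \<Longrightarrow> Poly_Mapping.single m c \<in> J"
  shows "monomial_span S \<subseteq> J"
proof
  fix p :: "('v, 'k) mpoly" assume p: "p \<in> monomial_span S"
  have "p = (\<Sum>m\<in>Poly_Mapping.keys p. Poly_Mapping.single m (Poly_Mapping.lookup p m))"
    by (rule poly_mapping_eqI)
      (auto simp: lookup_sum lookup_single when_def in_keys_iff)
  moreover have "(\<Sum>m\<in>A. Poly_Mapping.single m (Poly_Mapping.lookup p m)) \<in> J"
    if "finite A" "A \<subseteq> S" for A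
    using that by (induction A rule: finite_induct) (auto intro: assms)
  ultimately show "p \<in> J"
    using p unfolding monomial_span_def by (metis finite_keys mem_Collect_eq)
qed

lemma ideal_monomial_span:
  assumes "up_closed V S"
  shows "ideal (monomial_span S) (mpoly_ring V :: ('v, 'k::field) mpoly ring)"
proof -
  let ?R = "mpoly_ring V :: ('v, 'k) mpoly ring"
  interpret cring ?R by (rule cring_mpoly_ring)
  have carr: "monomial_span S \<subseteq> carrier ?R"
    using assms by (simp add: carrier_mpoly_ring up_closed_def monomial_span_mono)
  have absorb: "x * a \<in> monomial_span S" if "a \<in> monomial_span S" "x \<in> carrier ?R" for a x
  proof -
    have "x * a \<in> monomial_span {n + m | n m. n \<in> mons V \<and> m \<in> S}"
      using that by (intro monomial_span_mult) (simp_all add: carrier_mpoly_ring)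
    also have "\<dots> \<subseteq> monomial_span S"
      using assms by (intro monomial_span_mono) (auto simp: up_closed_def)
    finally show ?thesis .
  qed
  have uminus: "\<ominus>\<^bsub>?R\<^esub> x = - x" if "x \<in> monomial_span S" for x :: "('v, 'k) mpoly"
  proof (rule minus_equality)
    show "- x \<in> carrier ?R" "x \<in> carrier ?R"
      using that carr by (auto simp: monomial_span_def carrier_mpoly_ring)
  qed simp
  show ?thesis
  proof (rule idealI)
    show "subgroup (monomial_span S) (add_monoid ?R)"
    proof
      fix x :: "('v, 'k) mpoly" assume "x \<in> monomial_span S"
      then show "inv\<^bsub>add_monoid ?R\<^esub> x \<in> monomial_span S"
        using uminus[of x] by (simp add: a_inv_def monomial_span_def)
    qed (use carr in \<open>auto simp: monomial_span_add\<close>, simp add: monomial_span_def)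
  next
    fix a x :: "('v, 'k) mpoly" assume "a \<in> monomial_span S" "x \<in> carrier ?R"
    then show "x \<otimes>\<^bsub>?R\<^esub> a \<in> monomial_span S" "a \<otimes>\<^bsub>?R\<^esub> x \<in> monomial_span S"
      using absorb[of a x] by (simp_all add: mult.commute[of a x])
  qed (rule ring_axioms)
qed

text \<open>
  The right-hand side is closed under multiplication by monomials, hence an ideal; each of its terms
  is a polynomial multiple of a generator.
\<close>

lemma genideal_monomials:
  assumes "G \<subseteq> mons V"
  shows "genideal (mpoly_ring V :: ('v, 'k::field) mpoly ring)
           ((\<lambda>g. Poly_Mapping.single g 1) ` G) =
         monomial_span {n + g | n g. n \<in> mons V \<and> g \<in> G}"
    (is "genideal ?R ?M = monomial_span ?S")
proof
  interpret cring ?R by (rule cring_mpoly_ring)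
  have M: "?M \<subseteq> carrier ?R"
    using assms by (auto simp: carrier_mpoly_ring)
  have up: "up_closed V ?S"
  proof -
    have "n' + (n + g) \<in> ?S" if "n \<in> mons V" "g \<in> G" "n' \<in> mons V" for n' n g
      using that mons_add[of n' V n] by (auto simp flip: add.assoc)
    then show ?thesis
      using assms by (auto simp: up_closed_def intro!: mons_add)
  qed
  have "g \<in> ?S" if "g \<in> G" for g
    using that mons_0[of V] by force
  then show "genideal ?R ?M \<subseteq> monomial_span ?S"
    by (intro genideal_minimal ideal_monomial_span up) auto
  interpret J: ideal "genideal ?R ?M" ?R
    by (rule genideal_ideal[OF M])
  show "monomial_span ?S \<subseteq> genideal ?R ?M"
  proof (rule monomial_span_subsetI)
    fix m c assume "m \<in> ?S"
    then obtain n g where m: "m = n + g" "n \<in> mons V" "g \<in> G" by blast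
    have "Poly_Mapping.single n c \<otimes>\<^bsub>?R\<^esub> Poly_Mapping.single g 1 \<in> genideal ?R ?M"
      using m genideal_self[OF M] by (intro J.I_l_closed) (auto simp: carrier_mpoly_ring)
    then show "Poly_Mapping.single m c \<in> genideal ?R ?M"
      by (simp add: mult_single m)
  qed (use J.zero_closed J.a_closed in simp_all)
qed

text \<open>
  Although a single product of polynomials may cancel terms, each term of the sumset is itself a
  product of two terms, so the ideal product is again spanned by monomials.
\<close>

lemma ideal_prod_monomial_span:
  "ideal_prod (mpoly_ring V :: ('v, 'k::field) mpoly ring) (monomial_span S) (monomial_span T) =
     monomial_span {m + n | m n. m \<in> S \<and> n \<in> T}"
    (is "ideal_prod ?R _ _ = monomial_span ?U")
proof
  show "ideal_prod ?R (monomial_span S) (monomial_span T) \<subseteq> monomial_span ?U"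
  proof
    fix p assume "p \<in> ideal_prod ?R (monomial_span S) (monomial_span T)"
    then show "p \<in> monomial_span ?U"
      by induction (simp_all add: monomial_span_mult monomial_span_add)
  qed
  show "monomial_span ?U \<subseteq> ideal_prod ?R (monomial_span S) (monomial_span T)"
  proof (rule monomial_span_subsetI)
    have "0 \<otimes>\<^bsub>?R\<^esub> 0 \<in> ideal_prod ?R (monomial_span S) (monomial_span T)"
      by (rule ideal_prod.prod) (simp_all add: monomial_span_def)
    then show "0 \<in> ideal_prod ?R (monomial_span S) (monomial_span T)" by simp
  next
    fix p q
    assume "p \<in> ideal_prod ?R (monomial_span S) (monomial_span T)"
      "q \<in> ideal_prod ?R (monomial_span S) (monomial_span T)"
    from ideal_prod.sum[OF this]
    show "p + q \<in> ideal_prod ?R (monomial_span S) (monomial_span T)" by simp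
  next
    fix m and c :: 'k assume "m \<in> ?U"
    then obtain a b where m: "m = a + b" "a \<in> S" "b \<in> T" by blast
    have "Poly_Mapping.single a c \<otimes>\<^bsub>?R\<^esub> Poly_Mapping.single b 1
            \<in> ideal_prod ?R (monomial_span S) (monomial_span T)"
      using m by (intro ideal_prod.prod) auto
    then show "Poly_Mapping.single m c \<in> ideal_prod ?R (monomial_span S) (monomial_span T)"
      by (simp add: mult_single m)
  qed
qed

text \<open>Multiplication by a monomial merely shifts the terms of a polynomial, without cancellation.\<close>

lemma lookup_single_mult:
  "Poly_Mapping.lookup (Poly_Mapping.single m c * p) (m + n) = c * Poly_Mapping.lookup p n"
    for p :: "('v, 'k::field) mpoly"
proof -
  have "Poly_Mapping.lookup (Poly_Mapping.single m c * p) (m + n) =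
      (\<Sum>l. if l = m then c * (\<Sum>q. Poly_Mapping.lookup p q when m + n = l + q) else 0)"
    unfolding lookup_mult by (rule Sum_any.cong) (simp add: lookup_single when_def)
  also have "\<dots> = c * (\<Sum>q. Poly_Mapping.lookup p q when n = q)"
    by (subst Sum_any.delta) simp
  also have "\<dots> = c * Poly_Mapping.lookup p n" by simp
  finally show ?thesis .
qed

section \<open>The irrelevant maximal ideal\<close>

lemma mons_nonzero_eq:
  "mons V - {0} = {n + g | n g. n \<in> mons V \<and> g \<in> (\<lambda>i. Poly_Mapping.single i 1) ` V}"
    (is "_ = ?S")
proof (intro equalityI subsetI)
  fix m assume "m \<in> ?S"
  then obtain n i where "m = n + Poly_Mapping.single i 1" "n \<in> mons V" "i \<in> V" by blast
  moreover from this have "Poly_Mapping.lookup m i \<noteq> 0"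
    by (simp add: lookup_add)
  ultimately show "m \<in> mons V - {0}" by (auto intro!: mons_add)
next
  fix m assume m: "m \<in> mons V - {0}"
  then have "Poly_Mapping.keys m \<noteq> {}" by simp
  then obtain i where i: "i \<in> Poly_Mapping.keys m" by blast
  have "m = (m - Poly_Mapping.single i 1) + Poly_Mapping.single i 1"
    using i by (intro poly_mapping_eqI)
      (auto simp: lookup_add lookup_minus lookup_single when_def in_keys_iff)
  moreover have "m - Poly_Mapping.single i 1 \<in> mons V"
    using m by (auto simp: mons_def in_keys_iff lookup_minus subset_iff)
  moreover have "i \<in> V" using i m by (auto simp: mons_def)
  ultimately show "m \<in> ?S" by blast
qed

lemma genideal_Vars:
  "genideal (mpoly_ring V :: ('v, 'k::field) mpoly ring) {Var i | i. i \<in> V} =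
     monomial_span (mons V - {0})"
proof -
  let ?G = "(\<lambda>i. Poly_Mapping.single i (1::nat)) ` V"
  have "{Var i | i. i \<in> V} = (\<lambda>g. Poly_Mapping.single g (1::'k)) ` ?G"
    by (auto simp: Var_def)
  then show ?thesis
    using genideal_monomials[of ?G V, where 'k = 'k] by (simp add: mons_nonzero_eq image_subset_iff)
qed

lemma up_closed_nonzero: "up_closed V (mons V - {0})"
proof -
  have "n + m \<noteq> 0" if "m \<noteq> 0" for n m :: "'a \<Rightarrow>\<^sub>0 nat"
  proof
    assume "n + m = 0"
    then have "Poly_Mapping.lookup n i + Poly_Mapping.lookup m i = 0" for i
      by (metis lookup_add lookup_zero)
    then have "m = 0" by (intro poly_mapping_eqI) simp
    with that show False by simp
  qed
  then show ?thesis by (auto simp: up_closed_def mons_add)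
qed

lemma in_irrelevant_iff:
  "p \<in> monomial_span (mons V - {0}) \<longleftrightarrow>
     p \<in> carrier (mpoly_ring V) \<and> Poly_Mapping.lookup p 0 = 0"
  by (auto simp: carrier_mpoly_ring monomial_span_def in_keys_iff)

text \<open>
  Subtracting its constant term from \<open>p\<close> gives an element of the irrelevant ideal, and the product
  of that element with \<open>q\<close> has no constant term.
\<close>

lemma lookup_mult_0:
  "Poly_Mapping.lookup (p * q) 0 = Poly_Mapping.lookup p 0 * Poly_Mapping.lookup q 0"
    for p q :: "('v, 'k::field) mpoly"
proof -
  let ?c = "Poly_Mapping.single 0 (Poly_Mapping.lookup p 0)"
  interpret ideal "monomial_span (mons UNIV - {0})" "mpoly_ring UNIV :: ('v, 'k) mpoly ring"
    by (rule ideal_monomial_span[OF up_closed_nonzero])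
  have UNIV: "x \<in> carrier (mpoly_ring UNIV)" for x :: "('v, 'k) mpoly"
    by (simp add: mpoly_ring_def)
  have "p - ?c \<in> monomial_span (mons UNIV - {0})"
    by (simp add: in_irrelevant_iff UNIV lookup_minus)
  from I_r_closed[OF this UNIV[of q]]
  have "Poly_Mapping.lookup ((p - ?c) * q) 0 = 0"
    by (simp add: in_irrelevant_iff)
  then show ?thesis
    using lookup_single_mult[of 0 "Poly_Mapping.lookup p 0" q 0]
    by (simp add: algebra_simps lookup_minus)
qed

lemma primeideal_irrelevant:
  "primeideal (monomial_span (mons V - {0})) (mpoly_ring V :: ('v, 'k::field) mpoly ring)"
proof (rule primeidealI)
  have "(1 :: ('v, 'k) mpoly) \<in> carrier (mpoly_ring V)"
    by (simp add: mpoly_ring_def)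
  then show "carrier (mpoly_ring V :: ('v, 'k) mpoly ring) \<noteq> monomial_span (mons V - {0})"
    using in_irrelevant_iff[of "1 :: ('v, 'k) mpoly" V] by auto
qed (auto simp: ideal_monomial_span up_closed_nonzero cring_mpoly_ring in_irrelevant_iff lookup_mult_0)

section \<open>Associated primes and depth\<close>

lemma annihilator_quot_module:
  assumes "cring R" "ideal I R" "f \<in> carrier R"
  shows "annihilator R (quot_module R I) (I +>\<^bsub>R\<^esub> f) = {a \<in> carrier R. a \<otimes>\<^bsub>R\<^esub> f \<in> I}"
proof -
  interpret cring R by fact
  interpret I: ideal I R by fact
  have "(I +>\<^bsub>R\<^esub> a) \<otimes>\<^bsub>R Quot I\<^esub> (I +>\<^bsub>R\<^esub> f) = \<zero>\<^bsub>R Quot I\<^esub> \<longleftrightarrow> a \<otimes>\<^bsub>R\<^esub> f \<in> I"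
    if "a \<in> carrier R" for a
    using that assms(3) I.rcoset_mult_add[of a f] I.a_rcos_const[of "a \<otimes>\<^bsub>R\<^esub> f"]
      I.a_rcos_self[of "a \<otimes>\<^bsub>R\<^esub> f"]
    by (auto simp: FactRing_def)
  then show ?thesis
    by (auto simp: annihilator_def quot_module_def)
qed

text \<open>
  With \<open>P\<close> the annihilator of \<open>x\<close>, which is not zero since \<open>P\<close> is proper, every element of \<open>P\<close> is a
  zero divisor on \<open>M\<close>. Thus only the empty sequence in \<open>P\<close> can be regular.
\<close>

lemma depth_associated_prime:
  assumes "Module.module R M" "P \<in> associated_primes R M"
  shows "depth R P M = 0"
proof -
  interpret Module.module R M by fact
  from assms(2) obtain x where P: "primeideal P R" and x: "x \<in> carrier M" "P = annihilator R M x"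
    by (auto simp: associated_primes_def)
  interpret P: primeideal P R by fact
  have nz: "x \<noteq> \<zero>\<^bsub>M\<^esub>"
  proof
    assume "x = \<zero>\<^bsub>M\<^esub>"
    then have "P = carrier R"
      unfolding x(2) annihilator_def using smult_r_null by blast
    with P.I_notcarr show False by simp
  qed
  have nil: "seq_smult M [] = {\<zero>\<^bsub>M\<^esub>}"
    by (auto simp: seq_smult_def)
  have "as = []" if as: "set as \<subseteq> P" "regular_sequence R M as" for as
  proof (rule ccontr)
    assume "as \<noteq> []"
    then have len: "0 < length as" by simp
    with as(1) have "as ! 0 \<in> P" using nth_mem by blast
    then have "(as ! 0) \<odot>\<^bsub>M\<^esub> x = \<zero>\<^bsub>M\<^esub>"
      unfolding x(2) annihilator_def by blast
    then have "(as ! 0) \<odot>\<^bsub>M\<^esub> x \<in> seq_smult M (take 0 as)"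
      by (simp only: take_0 nil singleton_iff)
    with as(2) len x(1) have "x \<in> seq_smult M (take 0 as)"
      unfolding regular_sequence_def by blast
    with nz nil show False by simp
  qed
  then have "{enat (length as) | as. set as \<subseteq> P \<and> regular_sequence R M as} \<subseteq> {0}"
    by (auto simp: zero_enat_def)
  then have "Sup {enat (length as) | as. set as \<subseteq> P \<and> regular_sequence R M as} \<le> 0"
    by (intro Sup_least) auto
  moreover have "carrier M \<noteq> {\<zero>\<^bsub>M\<^esub>}" using x nz by blast
  ultimately show ?thesis by (simp add: depth_def)
qed

text \<open>
  The monomials that form a basis of the socle of the quotient by the ideal spanned by \<open>S\<close>.
\<close>

definition corner :: "'v set \<Rightarrow> ('v \<Rightarrow>\<^sub>0 nat) set \<Rightarrow> ('v \<Rightarrow>\<^sub>0 nat) \<Rightarrow> bool" where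
  "corner V S w \<longleftrightarrow> w \<in> mons V - S \<and> (\<forall>i \<in> V. Poly_Mapping.single i 1 + w \<in> S)"

text \<open>
  If the irrelevant ideal is the annihilator of the class of \<open>f\<close>, then some term \<open>w\<close> of \<open>f\<close> lies outside
  the ideal; multiplication by a variable shifts the terms of \<open>f\<close> without cancellation, so every
  variable moves \<open>w\<close> into \<open>S\<close>. Conversely, the class of a corner \<open>w\<close> is killed by every variable but
  not by a polynomial with constant term \<open>c \<noteq> 0\<close>, since \<open>c\<close> becomes the coefficient of \<open>w\<close> in the
  product.
\<close>

lemma irrelevant_in_Ass_iff:
  assumes "up_closed V S"
  shows "monomial_span (mons V - {0}) \<in>
           Ass (mpoly_ring V :: ('v, 'k::field) mpoly ring) (monomial_span S) \<longleftrightarrow>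
         (\<exists>w. corner V S w)"
proof
  let ?R = "mpoly_ring V :: ('v, 'k) mpoly ring"
  let ?I = "monomial_span S :: ('v, 'k) mpoly set"
  let ?m = "monomial_span (mons V - {0}) :: ('v, 'k) mpoly set"
  interpret cring ?R by (rule cring_mpoly_ring)
  note I = ideal_monomial_span[OF assms, where 'k = 'k]
  interpret I: ideal ?I ?R by (rule I)
  have ann: "annihilator ?R (quot_module ?R ?I) (?I +>\<^bsub>?R\<^esub> f) =
      {a \<in> carrier ?R. a * f \<in> ?I}" if "f \<in> carrier ?R" for f
    using annihilator_quot_module[OF cring_mpoly_ring I that] by simp
  {
    assume "?m \<in> Ass ?R ?I"
    then obtain x where x: "x \<in> carrier (quot_module ?R ?I)"
      "?m = annihilator ?R (quot_module ?R ?I) x"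
      by (auto simp: Ass_def associated_primes_def)
    then obtain f where f: "f \<in> carrier ?R" "x = ?I +>\<^bsub>?R\<^esub> f"
      by (auto simp: quot_module_def FactRing_def A_RCOSETS_def')
    have m: "a \<in> ?m \<longleftrightarrow> a \<in> carrier ?R \<and> a * f \<in> ?I" for a
      using x(2) f ann by auto
    have "(1 :: ('v, 'k) mpoly) \<notin> ?m" by (simp add: in_irrelevant_iff)
    then have "f \<notin> ?I" using m[of 1] one_closed by simp
    then obtain w where w: "w \<in> Poly_Mapping.keys f" "w \<notin> S"
      by (auto simp: monomial_span_def)
    have "Poly_Mapping.single i 1 + w \<in> S" if "i \<in> V" for i
    proof -
      have "Poly_Mapping.single i (1::nat) \<noteq> 0" by (metis keys_single keys_zero insert_not_empty one_neq_zero)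
      then have "Var i \<in> ?m" using that by (simp add: Var_def)
      then have "Var i * f \<in> ?I" using m by blast
      moreover have "Poly_Mapping.single i 1 + w \<in> Poly_Mapping.keys (Var i * f)"
        using w(1) lookup_single_mult[of "Poly_Mapping.single i 1" 1 f w]
        by (simp add: in_keys_iff Var_def)
      ultimately show ?thesis by (auto simp: monomial_span_def)
    qed
    moreover have "w \<in> mons V"
      using f(1) w(1) by (auto simp: carrier_mpoly_ring monomial_span_def)
    ultimately show "\<exists>w. corner V S w" using w(2) by (auto simp: corner_def)
  }
  {
    assume "\<exists>w. corner V S w"
    then obtain w where w: "w \<in> mons V" "w \<notin> S"
      "\<And>i. i \<in> V \<Longrightarrow> Poly_Mapping.single i 1 + w \<in> S"
      by (auto simp: corner_def)
    let ?w = "Poly_Mapping.single w 1 :: ('v, 'k) mpoly"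
    have wR: "?w \<in> carrier ?R" using w(1) by (simp add: carrier_mpoly_ring)
    have colon: "a * ?w \<in> ?I \<longleftrightarrow> a \<in> ?m" if a: "a \<in> carrier ?R" for a
    proof
      assume "a * ?w \<in> ?I"
      then have "Poly_Mapping.lookup (a * ?w) w = 0"
        using w(2) by (auto simp: monomial_span_def in_keys_iff)
      then show "a \<in> ?m"
        using a lookup_single_mult[of w 1 a 0] by (simp add: in_irrelevant_iff mult.commute)
    next
      assume "a \<in> ?m"
      moreover have "monomial_span (mons V - {0}) \<subseteq> {a. a * ?w \<in> ?I}"
      proof (rule monomial_span_subsetI)
        fix n and c :: 'k assume n: "n \<in> mons V - {0}"
        then have "n \<in> {m + g | m g. m \<in> mons V \<and> g \<in> (\<lambda>i. Poly_Mapping.single i 1) ` V}"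
          using mons_nonzero_eq by blast
        then obtain m i where "n = m + Poly_Mapping.single i 1" "m \<in> mons V" "i \<in> V" by blast
        then have "n + w \<in> S"
          using assms w(3)[of i] by (auto simp: up_closed_def add.assoc)
        then show "Poly_Mapping.single n c \<in> {a. a * ?w \<in> ?I}"
          by (simp add: mult_single)
      qed (use I.zero_closed I.a_closed in \<open>auto simp: distrib_right\<close>)
      ultimately show "a * ?w \<in> ?I" by blast
    qed
    have "?m = annihilator ?R (quot_module ?R ?I) (?I +>\<^bsub>?R\<^esub> ?w)"
      using ann[OF wR] colon by (auto simp: in_irrelevant_iff)
    moreover have "?I +>\<^bsub>?R\<^esub> ?w \<in> carrier (quot_module ?R ?I)"
      using wR by (auto simp: quot_module_def FactRing_def A_RCOSETS_def')
    ultimately show "?m \<in> Ass ?R ?I"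
      using primeideal_irrelevant unfolding Ass_def associated_primes_def by blast
  }
qed

section \<open>Powers of the closed neighborhood ideal\<close>

definition sqfree_exp :: "'v set \<Rightarrow> ('v \<Rightarrow>\<^sub>0 nat)" where
  "sqfree_exp U = (\<Sum>u\<in>U. Poly_Mapping.single u 1)"

lemma lookup_sqfree_exp:
  "finite U \<Longrightarrow> Poly_Mapping.lookup (sqfree_exp U) i = (if i \<in> U then 1 else 0)"
  by (simp add: sqfree_exp_def lookup_sum lookup_single when_def)

lemma prod_Var:
  "(\<Prod>u\<in>U. Var u) = (Poly_Mapping.single (sqfree_exp U) 1 :: ('v, 'k::field) mpoly)"
  by (induction U rule: infinite_finite_induct) (simp_all add: sqfree_exp_def Var_def mult_single)

lemma sqfree_exp_in_mons: "U \<subseteq> V \<Longrightarrow> sqfree_exp U \<in> mons V"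
  unfolding sqfree_exp_def by (auto intro!: mons_sum)

text \<open>
  These inequalities say that the monomial is divisible by a product of \<open>a\<close> generators
  \<open>sqfree_exp (insert v Y)\<close>, \<open>v \<in> X\<close>, and \<open>b\<close> generators \<open>sqfree_exp (insert v X)\<close>, \<open>v \<in> Y\<close>: the
  former contribute \<open>a\<close> to each exponent on \<open>Y\<close> and, at freely chosen places, \<open>a\<close> to the degree in \<open>X\<close>,
  and symmetrically for the latter.
\<close>

definition has_gen_factors ::
    "'v set \<Rightarrow> 'v set \<Rightarrow> nat \<Rightarrow> nat \<Rightarrow> ('v \<Rightarrow>\<^sub>0 nat) \<Rightarrow> bool" where
  "has_gen_factors X Y a b m \<longleftrightarrow>
     (\<forall>i\<in>X. b \<le> Poly_Mapping.lookup m i) \<and> (\<forall>j\<in>Y. a \<le> Poly_Mapping.lookup m j) \<and>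
     card X * b + a \<le> (\<Sum>i\<in>X. Poly_Mapping.lookup m i) \<and>
     card Y * a + b \<le> (\<Sum>j\<in>Y. Poly_Mapping.lookup m j)"

lemma has_gen_factors_swap: "has_gen_factors X Y a b m \<longleftrightarrow> has_gen_factors Y X b a m"
  by (auto simp: has_gen_factors_def)

lemma has_gen_factors_add: "has_gen_factors X Y a b m \<Longrightarrow> has_gen_factors X Y a b (n + m)"
  by (auto simp: has_gen_factors_def lookup_add sum.distrib intro: trans_le_add2)

lemma sum_lookup_sqfree_exp:
  "finite A \<Longrightarrow> finite U \<Longrightarrow> (\<Sum>i\<in>A. Poly_Mapping.lookup (sqfree_exp U) i) = card (A \<inter> U)"
  by (simp add: lookup_sqfree_exp sum.If_cases)

lemma has_gen_factors_extend:
  assumes fin: "finite X" "finite Y" "X \<inter> Y = {}" and v: "v \<in> X" and n: "has_gen_factors X Y a b n"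
  shows "has_gen_factors X Y (Suc a) b (n + sqfree_exp (insert v Y))"
proof -
  have "X \<inter> insert v Y = {v}" "Y \<inter> insert v Y = Y" using fin v by auto
  then show ?thesis
    using fin n unfolding has_gen_factors_def
    by (auto simp: lookup_add sum.distrib sum_lookup_sqfree_exp)
      (auto simp: lookup_sqfree_exp)
qed

text \<open>
  The degree in \<open>X\<close> exceeds \<open>card X * b\<close>, so some exponent on \<open>X\<close> exceeds the required minimum \<open>b\<close>;
  that variable is the \<open>v\<close> of a generator that can be split off. Iterating this turns the
  inequalities into an actual product of generators.
\<close>

lemma has_gen_factors_peel:
  assumes fin: "finite X" "finite Y" "X \<inter> Y = {}" and m: "has_gen_factors X Y (Suc a) b m"
  obtains v n where "v \<in> X" "m = n + sqfree_exp (insert v Y)" "has_gen_factors X Y a b n"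
proof -
  have "\<exists>v\<in>X. b < Poly_Mapping.lookup m v"
  proof (rule ccontr)
    assume "\<not> ?thesis"
    then have "(\<Sum>i\<in>X. Poly_Mapping.lookup m i) \<le> card X * b"
      using sum_bounded_above[of X "Poly_Mapping.lookup m" b] by (auto simp: not_less)
    then show False using m by (simp add: has_gen_factors_def)
  qed
  then obtain v where v: "v \<in> X" "b < Poly_Mapping.lookup m v" by blast
  let ?g = "sqfree_exp (insert v Y)"
  define n where "n = m - ?g"
  have mn: "m = n + ?g"
    using v m fin unfolding n_def
    by (intro poly_mapping_eqI)
      (auto simp: lookup_add lookup_minus lookup_sqfree_exp has_gen_factors_def Suc_le_eq)
  have "X \<inter> insert v Y = {v}" "Y \<inter> insert v Y = Y" using fin v by auto
  then have sums: "(\<Sum>i\<in>X. Poly_Mapping.lookup m i) = (\<Sum>i\<in>X. Poly_Mapping.lookup n i) + 1"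
    "(\<Sum>i\<in>Y. Poly_Mapping.lookup m i) = (\<Sum>i\<in>Y. Poly_Mapping.lookup n i) + card Y"
    using fin by (simp_all add: mn lookup_add sum.distrib sum_lookup_sqfree_exp)
  have "b \<le> Poly_Mapping.lookup n i" if "i \<in> X" for i
    using that m v fin by (auto simp: n_def lookup_minus lookup_sqfree_exp has_gen_factors_def)
  moreover have "a \<le> Poly_Mapping.lookup n j" if "j \<in> Y" for j
    using that m fin by (force simp: n_def lookup_minus lookup_sqfree_exp has_gen_factors_def)
  ultimately have "has_gen_factors X Y a b n"
    using m sums by (simp add: has_gen_factors_def)
  with v mn that show thesis by blast
qed

definition power_exps :: "'v set \<Rightarrow> 'v set \<Rightarrow> nat \<Rightarrow> ('v \<Rightarrow>\<^sub>0 nat) set" where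
  "power_exps X Y t = {m \<in> mons (X \<union> Y). \<exists>a b. a + b = t \<and> has_gen_factors X Y a b m}"

definition gen_exps :: "'v set \<Rightarrow> 'v set \<Rightarrow> ('v \<Rightarrow>\<^sub>0 nat) set" where
  "gen_exps X Y = (\<lambda>v. sqfree_exp (insert v Y)) ` X \<union> (\<lambda>v. sqfree_exp (insert v X)) ` Y"

lemma gen_exps_in_mons: "gen_exps X Y \<subseteq> mons (X \<union> Y)"
  by (auto simp: gen_exps_def intro!: sqfree_exp_in_mons)

lemma up_closed_power_exps: "up_closed (X \<union> Y) (power_exps X Y t)"
  by (auto simp: up_closed_def power_exps_def mons_add) (metis has_gen_factors_add)

lemma power_exps_swap: "power_exps X Y t = power_exps Y X t"
  unfolding power_exps_def by (metis (lifting) has_gen_factors_swap add.commute Un_commute)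

lemma mons_addD: "n + g \<in> mons V \<Longrightarrow> n \<in> mons V"
  by (auto simp: mons_def in_keys_iff lookup_add subset_iff)

lemma power_exps_0: "power_exps X Y 0 = mons (X \<union> Y)"
  by (auto simp: power_exps_def has_gen_factors_def)

text \<open>
  This recursion is the one satisfied by the powers of the ideal. Generators with
  \<open>v \<in> X\<close> are split off or multiplied on directly, those with \<open>v \<in> Y\<close> after exchanging the parts.
\<close>

lemma power_exps_Suc:
  assumes fin: "finite X" "finite Y" "X \<inter> Y = {}"
  shows "power_exps X Y (Suc t) = {n + g | n g. n \<in> power_exps X Y t \<and> g \<in> gen_exps X Y}"
proof (intro equalityI subsetI)
  have fin': "Y \<inter> X = {}" using fin by auto
  fix m assume "m \<in> power_exps X Y (Suc t)"
  then obtain a b where m: "m \<in> mons (X \<union> Y)" "a + b = Suc t" "has_gen_factors X Y a b m"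
    by (auto simp: power_exps_def)
  have "\<exists>n g. m = n + g \<and> g \<in> gen_exps X Y \<and> (\<exists>a b. a + b = t \<and> has_gen_factors X Y a b n)"
  proof (cases a)
    case (Suc a')
    with m obtain v n where v: "v \<in> X" "m = n + sqfree_exp (insert v Y)" "has_gen_factors X Y a' b n"
      using has_gen_factors_peel[OF fin] by metis
    moreover have "a' + b = t" using m Suc by simp
    ultimately show ?thesis unfolding gen_exps_def by blast
  next
    case 0
    with m have "b = Suc t" by simp
    with m 0 obtain v n where v: "v \<in> Y" "m = n + sqfree_exp (insert v X)" "has_gen_factors Y X t 0 n"
      using has_gen_factors_peel[OF fin(2,1) fin'] has_gen_factors_swap by metis
    moreover from this have "has_gen_factors X Y 0 t n" by (simp add: has_gen_factors_swap)
    moreover have "0 + t = t" by simp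
    ultimately show ?thesis unfolding gen_exps_def by blast
  qed
  then show "m \<in> {n + g | n g. n \<in> power_exps X Y t \<and> g \<in> gen_exps X Y}"
    using m(1) mons_addD unfolding power_exps_def by blast
next
  have fin': "Y \<inter> X = {}" using fin by auto
  fix m assume "m \<in> {n + g | n g. n \<in> power_exps X Y t \<and> g \<in> gen_exps X Y}"
  then obtain n g a b where m: "m = n + g" "n \<in> mons (X \<union> Y)" "g \<in> gen_exps X Y"
    "a + b = t" "has_gen_factors X Y a b n"
    by (auto simp: power_exps_def)
  have "\<exists>a b. a + b = Suc t \<and> has_gen_factors X Y a b m"
  proof (cases "g \<in> (\<lambda>v. sqfree_exp (insert v Y)) ` X")
    case True
    then have "has_gen_factors X Y (Suc a) b m" using has_gen_factors_extend[OF fin _ m(5)] m(1) by blast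
    moreover have "Suc a + b = Suc t" using m by simp
    ultimately show ?thesis by blast
  next
    case False
    then obtain v where "v \<in> Y" "g = sqfree_exp (insert v X)"
      using m(3) by (auto simp: gen_exps_def)
    then have "has_gen_factors X Y a (Suc b) m"
      using has_gen_factors_extend[OF fin(2,1) fin', of v b a n] m(1,5) has_gen_factors_swap by metis
    moreover have "a + Suc b = Suc t" using m by simp
    ultimately show ?thesis by blast
  qed
  then show "m \<in> power_exps X Y (Suc t)"
    using m gen_exps_in_mons[of X Y] by (auto simp: power_exps_def intro!: mons_add)
qed

lemma genideal_gen_exps:
  assumes "finite X" "finite Y" "X \<inter> Y = {}"
  shows "genideal (mpoly_ring (X \<union> Y) :: ('v, 'k::field) mpoly ring)
           ((\<lambda>g. Poly_Mapping.single g 1) ` gen_exps X Y) = monomial_span (power_exps X Y 1)"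
  by (simp add: genideal_monomials[OF gen_exps_in_mons] power_exps_Suc[OF assms] power_exps_0)

lemma power_genideal:
  assumes fin: "finite X" "finite Y" "X \<inter> Y = {}"
  defines "R \<equiv> mpoly_ring (X \<union> Y) :: ('v, 'k::field) mpoly ring"
  shows "genideal R ((\<lambda>g. Poly_Mapping.single g 1) ` gen_exps X Y) [^]\<^bsub>ideals_set R\<^esub> (t::nat) =
           monomial_span (power_exps X Y t)"
proof (induction t)
  case 0
  then show ?case
    by (simp add: nat_pow_def ideals_set_def R_def carrier_mpoly_ring power_exps_0)
next
  case (Suc t)
  note gen = genideal_gen_exps[OF fin, where 'k = 'k, folded R_def]
  have "{m + n | m n. m \<in> power_exps X Y t \<and> n \<in> power_exps X Y 1} = power_exps X Y (Suc t)"
  proof -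
    have "{m + n | m n. m \<in> power_exps X Y t \<and> n \<in> power_exps X Y 1} =
        {(n + m) + g | n m g. n \<in> mons (X \<union> Y) \<and> m \<in> power_exps X Y t \<and> g \<in> gen_exps X Y}"
      (is "?A = ?B")
    proof (intro equalityI subsetI)
      fix k assume "k \<in> ?A"
      then obtain m n g where "k = m + (n + g)" "m \<in> power_exps X Y t" "n \<in> mons (X \<union> Y)"
        "g \<in> gen_exps X Y"
        unfolding One_nat_def power_exps_Suc[OF fin, of 0] power_exps_0 by blast
      moreover from this have "k = n + m + g" by (simp add: ac_simps)
      ultimately show "k \<in> ?B" by blast
    next
      fix k assume "k \<in> ?B"
      then obtain m n g where "k = n + m + g" "m \<in> power_exps X Y t" "n \<in> mons (X \<union> Y)"
        "g \<in> gen_exps X Y" by blast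
      moreover from this have "k = m + (n + g)" by (simp add: ac_simps)
      ultimately show "k \<in> ?A"
        unfolding One_nat_def power_exps_Suc[OF fin, of 0] power_exps_0 by blast
    qed
    also have "\<dots> = {m + g | m g. m \<in> power_exps X Y t \<and> g \<in> gen_exps X Y}"
      using up_closed_power_exps[of X Y t] mons_0[of "X \<union> Y"] unfolding up_closed_def
      by (metis (no_types, opaque_lifting) add_0)
    finally show ?thesis by (simp add: power_exps_Suc[OF fin])
  qed
  then show ?case
    using Suc unfolding gen
    by (simp add: nat_pow_def ideals_set_def R_def ideal_prod_monomial_span)
qed

lemma NI_complete_bipartite:
  "NI R (with_proj (complete_bipartite r s)) =
     genideal R ((\<lambda>g. Poly_Mapping.single g (1::'k::field)) ` gen_exps {1..r} {r + 1..r + s})"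
proof -
  let ?G = "with_proj (complete_bipartite r s)"
  let ?X = "{1..r}" and ?Y = "{r + 1..r + s}"
  have nbhd: "closed_nbhd ?G v = insert v ?Y" if "v \<in> ?X" for v
    using that by (auto simp: closed_nbhd_def complete_bipartite_def)
  have nbhd': "closed_nbhd ?G v = insert v ?X" if "v \<in> ?Y" for v
    using that by (auto simp: closed_nbhd_def complete_bipartite_def)
  have "{\<Prod>u \<in> closed_nbhd ?G v. Var u | v. v \<in> verts ?G} =
      (\<lambda>v. Poly_Mapping.single (sqfree_exp (closed_nbhd ?G v)) (1::'k)) ` (?X \<union> ?Y)"
    by (auto simp: prod_Var complete_bipartite_def)
  also have "\<dots> = (\<lambda>g. Poly_Mapping.single g 1) ` gen_exps ?X ?Y"
    unfolding gen_exps_def image_Un image_image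
    by (intro arg_cong2[of _ _ _ _ "(\<union>)"] image_cong) (simp_all only: nbhd nbhd')
  finally show ?thesis by (simp add: NI_def)
qed

section \<open>Corners of the powers\<close>

lemma has_gen_factors_single_add:
  assumes "finite X" "finite Y" "X \<inter> Y = {}" "i \<in> X"
  shows "has_gen_factors X Y a b (Poly_Mapping.single i 1 + w) \<longleftrightarrow>
     (\<forall>k\<in>X. b \<le> Poly_Mapping.lookup w k + (if k = i then 1 else 0)) \<and>
     (\<forall>j\<in>Y. a \<le> Poly_Mapping.lookup w j) \<and>
     card X * b + a \<le> (\<Sum>i\<in>X. Poly_Mapping.lookup w i) + 1 \<and>
     card Y * a + b \<le> (\<Sum>j\<in>Y. Poly_Mapping.lookup w j)"
proof -
  have "(\<Sum>k\<in>X. Poly_Mapping.lookup (Poly_Mapping.single i (1::nat)) k) = 1"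
    "(\<Sum>j\<in>Y. Poly_Mapping.lookup (Poly_Mapping.single i (1::nat)) j) = 0"
    using assms by (auto simp: lookup_single when_def)
  moreover have "Poly_Mapping.lookup (Poly_Mapping.single i (1::nat)) j = 0" if "j \<in> Y" for j
    using that assms by (auto simp: lookup_single when_def)
  ultimately show ?thesis
    unfolding has_gen_factors_def by (auto simp: lookup_add sum.distrib lookup_single when_def)
qed

text \<open>
  Raising the exponent at one place \<open>i\<close> does not help the exponents at the other places. As \<open>X\<close> has
  at least two elements, every exponent on \<open>X\<close> already is at least \<open>t\<close> before the shift.
\<close>

lemma has_gen_factors_0_if_shifted:
  assumes fin: "finite X" "finite Y" "X \<inter> Y = {}" and "2 \<le> card X"
    and shift: "\<And>i. i \<in> X \<Longrightarrow> has_gen_factors X Y 0 t (Poly_Mapping.single i 1 + w)"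
  shows "has_gen_factors X Y 0 t w"
proof -
  note s = has_gen_factors_single_add[OF fin, THEN iffD1, OF _ shift]
  have le: "t \<le> Poly_Mapping.lookup w k" if k: "k \<in> X" for k
  proof -
    have "\<not> X \<subseteq> {k}" using \<open>2 \<le> card X\<close> card_mono[of "{k}" X] by auto
    then obtain i where "i \<in> X" "i \<noteq> k" by blast
    with s[of i] k show ?thesis by auto
  qed
  moreover obtain i where "i \<in> X" using \<open>2 \<le> card X\<close> by fastforce
  moreover have "card X * t \<le> (\<Sum>i\<in>X. Poly_Mapping.lookup w i)"
    using sum_bounded_below[of X t "Poly_Mapping.lookup w"] le by simp
  ultimately show ?thesis using shift[of i] s[of i] by (simp add: has_gen_factors_def)
qed

text \<open>
  Since the splitting \<open>(0, t)\<close> cannot serve all variables in \<open>X\<close>, one of them enters the ideal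
  through a splitting with \<open>a > 0\<close>. Its exponents on \<open>Y\<close> are those of \<open>w\<close>, and its degree in \<open>X\<close> is
  one higher.
\<close>

lemma corner_shiftE:
  assumes fin: "finite X" "finite Y" "X \<inter> Y = {}" and "2 \<le> card X"
    and w: "corner (X \<union> Y) (power_exps X Y t) w"
  obtains a b where "a + b = t" "0 < a" "\<forall>j\<in>Y. a \<le> Poly_Mapping.lookup w j"
    "card X * b + a \<le> (\<Sum>i\<in>X. Poly_Mapping.lookup w i) + 1"
    "card Y * a + b \<le> (\<Sum>j\<in>Y. Poly_Mapping.lookup w j)"
proof -
  have "\<not> has_gen_factors X Y 0 t w" using w by (auto simp: corner_def power_exps_def)
  then obtain i where i: "i \<in> X" "\<not> has_gen_factors X Y 0 t (Poly_Mapping.single i 1 + w)"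
    using has_gen_factors_0_if_shifted[OF fin \<open>2 \<le> card X\<close>] by blast
  have "Poly_Mapping.single i 1 + w \<in> power_exps X Y t"
    using w i by (auto simp: corner_def)
  then obtain a b where ab: "a + b = t" "has_gen_factors X Y a b (Poly_Mapping.single i 1 + w)"
    by (auto simp: power_exps_def)
  with i have "0 < a" by (metis add_0 gr0I)
  with ab that show thesis unfolding has_gen_factors_single_add[OF fin i(1)] by blast
qed

text \<open>
  Some variable in \<open>X\<close> enters through a splitting \<open>(a, b)\<close> with \<open>a > 0\<close>, some variable in \<open>Y\<close> through
  a splitting \<open>(c, d)\<close> with \<open>d > 0\<close>. For \<open>t = 1\<close> and \<open>t = 2\<close> this leaves so few values that the lower bounds from
  the second splitting make up for the one unit of degree that the first one may lack, or the other
  way round; then the corner itself lies in the ideal.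
\<close>

lemma no_corner_power_exps:
  assumes fin: "finite X" "finite Y" "X \<inter> Y = {}" and card: "2 \<le> card X" "2 \<le> card Y"
    and t: "t = 1 \<or> t = 2"
  shows "\<not> corner (X \<union> Y) (power_exps X Y t) w"
proof
  assume w: "corner (X \<union> Y) (power_exps X Y t) w"
  have w': "corner (Y \<union> X) (power_exps Y X t) w"
    using w by (simp add: Un_commute power_exps_swap)
  have no: "\<not> has_gen_factors X Y a b w" if "a + b = t" for a b
    using w that by (auto simp: corner_def power_exps_def)
  let ?p = "\<Sum>i\<in>X. Poly_Mapping.lookup w i" and ?q = "\<Sum>j\<in>Y. Poly_Mapping.lookup w j"
  obtain a b where A: "a + b = t" "0 < a" "\<forall>j\<in>Y. a \<le> Poly_Mapping.lookup w j"
    "card X * b + a \<le> ?p + 1" "card Y * a + b \<le> ?q"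
    using corner_shiftE[OF fin card(1) w] by blast
  have fin': "Y \<inter> X = {}" using fin by auto
  obtain d c where B: "d + c = t" "0 < d" "\<forall>i\<in>X. d \<le> Poly_Mapping.lookup w i"
    "card Y * c + d \<le> ?q + 1" "card X * d + c \<le> ?p"
    using corner_shiftE[OF fin(2,1) fin' card(2) w'] by blast
  have "(a, b) \<in> {(1, 0), (2, 0), (1, 1)}" "(c, d) \<in> {(0, 1), (0, 2), (1, 1)}"
    using A(1,2) B(1,2) t by auto
  then have "has_gen_factors X Y a b w \<or> has_gen_factors X Y c d w"
    using A B card unfolding has_gen_factors_def by auto
  with no A(1) B(1) show False by (metis add.commute)
qed

text \<open>
  The corner has all exponents on \<open>X\<close> equal to \<open>t - 1\<close> and all exponents on \<open>Y\<close> equal to \<open>2\<close>, except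
  for \<open>t - 1\<close> at one place \<open>y\<close>. Thus the degree in \<open>X\<close> is one short of what \<open>(1, t - 1)\<close> requires and
  the degree in \<open>Y\<close> one short of what \<open>(2, t - 2)\<close> requires. A variable in \<open>X\<close> repairs the first, a
  variable in \<open>Y\<close> the second.
\<close>

lemma corner_power_exps:
  assumes fin: "finite X" "finite Y" "X \<inter> Y = {}" and card: "2 \<le> card X" "2 \<le> card Y"
    and t: "3 \<le> t"
  shows "\<exists>w. corner (X \<union> Y) (power_exps X Y t) w"
proof -
  obtain y where y: "y \<in> Y" using card by fastforce
  have "\<not> Y \<subseteq> {y}" using card(2) card_mono[of "{y}" Y] by auto
  then obtain y' where y': "y' \<in> Y" "y' \<noteq> y" by blast
  obtain x where x: "x \<in> X" using card by fastforce
  define w where "w = (\<Sum>i\<in>X. Poly_Mapping.single i (t - 1)) + (\<Sum>j\<in>Y. Poly_Mapping.single j 2)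
    + Poly_Mapping.single y (t - 3)"
  have wX: "Poly_Mapping.lookup w i = t - 1" if "i \<in> X" for i
    using that fin y by (auto simp: w_def lookup_add lookup_sum lookup_single when_def)
  have wY: "Poly_Mapping.lookup w j = 2 + (if j = y then t - 3 else 0)" if "j \<in> Y" for j
    using that fin y by (auto simp: w_def lookup_add lookup_sum lookup_single when_def)
  have p: "(\<Sum>i\<in>X. Poly_Mapping.lookup w i) = card X * (t - 1)" by (simp add: wX)
  have q: "(\<Sum>j\<in>Y. Poly_Mapping.lookup w j) = card Y * 2 + (t - 3)"
    using fin y by (simp add: wY sum.distrib del: add_2_eq_Suc add_2_eq_Suc')
  have "w \<in> mons (X \<union> Y)"
    unfolding w_def using y by (intro mons_add mons_sum mons_single) auto
  moreover have "\<not> has_gen_factors X Y a b w" if "a + b = t" for a b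
  proof
    assume F: "has_gen_factors X Y a b w"
    have b: "b \<le> t - 1" using F x wX by (auto simp: has_gen_factors_def)
    \<comment> \<open>The exponent at a second element of \<open>Y\<close> is exactly \<open>2\<close>.\<close>
    have a: "a \<le> 2" using F y' wY[of y'] by (auto simp: has_gen_factors_def)
    have "card X * b + a \<le> card X * (t - 1)" "card Y * a + b \<le> card Y * 2 + (t - 3)"
      using F unfolding has_gen_factors_def p q by auto
    \<comment> \<open>\<open>a = 0\<close> would force \<open>b = t\<close>, above the exponents on \<open>X\<close>.\<close>
    moreover have "a = 1 \<or> a = 2" using that a b t by auto
    moreover have "b = t - a" using that by simp
    ultimately show False using t by auto
  qed
  moreover have "Poly_Mapping.single i 1 + w \<in> power_exps X Y t" if "i \<in> X" for i
  proof -
    have "has_gen_factors X Y 1 (t - 1) (Poly_Mapping.single i 1 + w)"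
      unfolding has_gen_factors_single_add[OF fin that] p q using t card by (auto simp: wX wY)
    moreover have "1 + (t - 1) = t" using t by simp
    moreover have "Poly_Mapping.single i 1 + w \<in> mons (X \<union> Y)"
      using that \<open>w \<in> mons (X \<union> Y)\<close> by (intro mons_add mons_single) auto
    ultimately show ?thesis unfolding power_exps_def by blast
  qed
  moreover have "Poly_Mapping.single j 1 + w \<in> power_exps X Y t" if "j \<in> Y" for j
  proof -
    have fin': "Y \<inter> X = {}" using fin by auto
    have "card X * (t - 2) + 2 \<le> card X * (t - 1)"
    proof -
      have "t - 1 = (t - 2) + 1" using t by simp
      then show ?thesis using card by (simp only: distrib_left)
    qed
    then have "has_gen_factors Y X (t - 2) 2 (Poly_Mapping.single j 1 + w)"
      unfolding has_gen_factors_single_add[OF fin(2,1) fin' that] p q using t by (auto simp: wX wY)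
    then have "has_gen_factors X Y 2 (t - 2) (Poly_Mapping.single j 1 + w)" by (simp add: has_gen_factors_swap)
    moreover have "2 + (t - 2) = t" using t by simp
    moreover have "Poly_Mapping.single j 1 + w \<in> mons (X \<union> Y)"
      using that \<open>w \<in> mons (X \<union> Y)\<close> by (intro mons_add mons_single) auto
    ultimately show ?thesis unfolding power_exps_def by blast
  qed
  ultimately show ?thesis unfolding corner_def power_exps_def by blast
qed

theorem proposition4p2:
  fixes r s :: nat
    and R :: "(nat, 'k::field) mpoly ring"
    and I \<mm> :: "(nat, 'k) mpoly set"
  assumes "r > 1" and "s > 1"
    and "R = mpoly_ring {1..r + s}"
    and "I = NI R (with_proj (complete_bipartite r s))"
    and "\<mm> = genideal R {Var i | i. i \<in> {1..r + s}}"
  shows "(\<forall>t::nat \<ge> 3. \<mm> \<in> Ass R (I [^]\<^bsub>ideals_set R\<^esub> t) -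
           (Ass R I \<union> Ass R (I [^]\<^bsub>ideals_set R\<^esub> (2::nat)))) \<and>
         (\<forall>t::nat \<ge> 3. depth R \<mm> (quot_module R (I [^]\<^bsub>ideals_set R\<^esub> t)) = 0) \<and>
         (\<lambda>k::nat. depth R \<mm> (quot_module R (I [^]\<^bsub>ideals_set R\<^esub> k))) \<longlonglongrightarrow> 0"
proof -
  let ?X = "{1..r}" and ?Y = "{r + 1..r + s}"
  have XY: "finite ?X" "finite ?Y" "?X \<inter> ?Y = {}" "2 \<le> card ?X" "2 \<le> card ?Y"
    using assms(1,2) by auto
  have V: "{1..r + s} = ?X \<union> ?Y" by auto
  have R: "R = mpoly_ring (?X \<union> ?Y)" using assms(3) V by simp
  have I: "I = genideal R ((\<lambda>g. Poly_Mapping.single g 1) ` gen_exps ?X ?Y)"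
    by (simp add: assms(4) NI_complete_bipartite)
  have pow: "I [^]\<^bsub>ideals_set R\<^esub> t = monomial_span (power_exps ?X ?Y t)" for t :: nat
    unfolding I R by (rule power_genideal[OF XY(1-3)])
  have I1: "I = monomial_span (power_exps ?X ?Y 1)"
    unfolding I R by (rule genideal_gen_exps[OF XY(1-3)])
  have m: "\<mm> = monomial_span (mons (?X \<union> ?Y) - {0})"
    unfolding assms(3,5) genideal_Vars by (simp only: V)
  have Ass: "\<mm> \<in> Ass R (monomial_span (power_exps ?X ?Y t)) \<longleftrightarrow>
      (\<exists>w. corner (?X \<union> ?Y) (power_exps ?X ?Y t) w)" for t
    unfolding m R by (rule irrelevant_in_Ass_iff[OF up_closed_power_exps])
  have in_Ass: "\<mm> \<in> Ass R (I [^]\<^bsub>ideals_set R\<^esub> t)" if "3 \<le> t" for t :: nat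
    unfolding pow Ass by (rule corner_power_exps[OF XY that])
  moreover have "\<mm> \<notin> Ass R I"
    unfolding I1 Ass using no_corner_power_exps[OF XY] by blast
  moreover have "\<mm> \<notin> Ass R (I [^]\<^bsub>ideals_set R\<^esub> (2::nat))"
    unfolding pow Ass using no_corner_power_exps[OF XY] by blast
  moreover have depth: "depth R \<mm> (quot_module R (I [^]\<^bsub>ideals_set R\<^esub> t)) = 0" if "3 \<le> t" for t :: nat
  proof (rule depth_associated_prime)
    show "Module.module R (quot_module R (I [^]\<^bsub>ideals_set R\<^esub> t))"
      unfolding pow unfolding R
      by (intro module_quot_module cring_mpoly_ring ideal_monomial_span up_closed_power_exps)
    show "\<mm> \<in> associated_primes R (quot_module R (I [^]\<^bsub>ideals_set R\<^esub> t))"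
      using in_Ass[OF that] by (simp add: Ass_def)
  qed
  moreover have "(\<lambda>k::nat. depth R \<mm> (quot_module R (I [^]\<^bsub>ideals_set R\<^esub> k))) \<longlonglongrightarrow> 0"
    using depth by (intro tendsto_eventually eventually_sequentiallyI[of 3])
  ultimately show ?thesis by blast
qed

end
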